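(* Let $m\ge2$ and let $Y\subset\{0,\dots,m-1\}^{\mathbb{N}}$ be a uniquely ergodic subshift with unique ergodic measure $\nu$ such that $\operatorname{supp}(\nu)=Y$. Let $A_0,A_1,\dots,A_{m-1}$ be $m$ non-negative $d\times d$ matrices. Suppose that there exists a word $u=u_0u_1\cdots u_{\ell_0-1}$ ($\ell_0\ge1$) with letters in $\{0,\dots,m-1\}$ such that $$[u]\cap\operatorname{supp}\nu\neq\emptyset,\qquad A_{u_0}A_{u_1}\cdots A_{u_{\ell_0-1}}>0.$$ Then the Lyapunov exponent $$\lim_{n\to\infty}\frac1n\log\|A_{\omega_0}A_{\omega_1}\cdots A_{\omega_{n-1}}\|$$ exists (in $[-\infty,\infty)$) for every $\omega=(\omega_n)_{n\ge0}\in Y$.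
   Context: A subshift is a closed subset of $\{0,\dots,m-1\}^{\mathbb{N}}$ mapped into itself by the shift $\sigma$, $(\sigma x)_n=x_{n+1}$. It is uniquely ergodic if it carries exactly one $\sigma$-invariant probability measure. $[u]$ is the cylinder of sequences having $u$ as prefix. $B>0$ means all entries of $B$ are strictly positive. For non-negative $B=(b_{i,j})$, $\|B\|=\sum_{i,j}b_{i,j}$; convention $\log0=-\infty$. *)

theory Defs
  imports "HOL-Probability.Probability"
begin

(* One-sided sequences over {0..m-1} are functions nat => nat with values below m. The topology
   is the library's product topology on functions (nat being discrete), and "borel" below is its
   Borel sigma-algebra. *)

definition shift_map :: "(nat \<Rightarrow> nat) \<Rightarrow> (nat \<Rightarrow> nat)" where
  "shift_map x = (\<lambda>n. x (Suc n))"

(* The full shift on m symbols is closed in nat => nat, so closedness of Y in either space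
   means the same. *)
definition subshift :: "nat \<Rightarrow> (nat \<Rightarrow> nat) set \<Rightarrow> bool" where
  "subshift m Y \<longleftrightarrow>
     (\<forall>x\<in>Y. \<forall>n. x n < m) \<and> closed Y \<and> (\<forall>x\<in>Y. shift_map x \<in> Y)"

(* A probability measure carried by Y is represented by a Borel probability measure on the whole
   sequence space that gives Y mass 1; invariance is that its push-forward by the shift is itself. *)
definition invariant_prob :: "(nat \<Rightarrow> nat) set \<Rightarrow> (nat \<Rightarrow> nat) measure \<Rightarrow> bool" where
  "invariant_prob Y \<nu> \<longleftrightarrow>
     prob_space \<nu> \<and> sets \<nu> = sets borel \<and> emeasure \<nu> Y = 1 \<and> distr \<nu> borel shift_map = \<nu>"

definition uniquely_ergodic :: "(nat \<Rightarrow> nat) set \<Rightarrow> bool" where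
  "uniquely_ergodic Y \<longleftrightarrow> (\<exists>!\<nu>. invariant_prob Y \<nu>)"

definition msupp :: "'a::topological_space measure \<Rightarrow> 'a set" where
  "msupp \<nu> = {x. \<forall>U. open U \<longrightarrow> x \<in> U \<longrightarrow> emeasure \<nu> U > 0}"

definition cylinder :: "nat list \<Rightarrow> (nat \<Rightarrow> nat) set" where
  "cylinder u = {x. \<forall>i<length u. x i = u ! i}"

(* Ordered product of the A i along a word. The type real^'d^'d carries the componentwise
   product as its multiplication, so the list and set products of the library do not apply. *)
definition word_prod :: "(nat \<Rightarrow> real^'d^'d) \<Rightarrow> nat list \<Rightarrow> real^'d^'d" where
  "word_prod A w = foldr (\<lambda>i B. A i ** B) w (mat 1)"

(* The library's orders on vectors are componentwise, but its strict order only asks for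
   inequality in some component, hence the entrywise predicates. *)
definition nonneg_mat :: "real^'d^'d \<Rightarrow> bool" where
  "nonneg_mat B \<longleftrightarrow> (\<forall>i j. B $ i $ j \<ge> 0)"

definition pos_mat :: "real^'d^'d \<Rightarrow> bool" where
  "pos_mat B \<longleftrightarrow> (\<forall>i j. B $ i $ j > 0)"

(* Meant for non-negative matrices. *)
definition entry_norm :: "real^'d^'d \<Rightarrow> real" where
  "entry_norm B = (\<Sum>i\<in>UNIV. \<Sum>j\<in>UNIV. B $ i $ j)"

(* Meant for x >= 0; the library's real logarithm has ln 0 = 0. *)
definition ext_log :: "real \<Rightarrow> ereal" where
  "ext_log x = (if x = 0 then -\<infinity> else ereal (ln x))"

end

theory Submission
  imports Defs
begin

text \<open>
  Write \<open>N w\<close> for the norm of the product of the matrices along the word \<open>w\<close>. The norm is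
  submultiplicative on non-negative matrices, so \<open>n \<mapsto> ln (N (\<omega>\<^sub>0 \<dots> \<omega>\<^sub>n\<^sub>-\<^sub>1))\<close> is subadditive along the
  orbit. Subadditivity alone gives convergence at almost every point; a superadditive bound that
  matches it up to a constant gives convergence at every point.

  Unique ergodicity makes the frequency of each word converge to the measure of its cylinder,
  uniformly in the starting point (\<open>freq_tendsto_measure\<close>). The support of the measure is all of
  \<open>Y\<close>, so each word of the language has positive frequency and recurs with bounded gaps in all
  points of \<open>Y\<close> (\<open>bounded_gaps\<close>). In particular this holds for \<open>u\<close>. Since the product along \<open>u\<close> has
  positive entries, \<open>N (x @ u @ y)\<close> is at least a constant times \<open>N x * N y\<close>
  (\<open>entry_norm_sandwich_ge\<close>).

  If \<open>N w = 0\<close> for some word \<open>w\<close> of the language, then \<open>w\<close> occurs in every \<open>\<omega>\<close>, the products are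
  eventually zero and the exponent is \<open>-\<infinity>\<close>. Otherwise the weights of words of bounded length are
  bounded away from \<open>0\<close>, and as an occurrence of \<open>u\<close> is never far from the junction of
  \<open>x\<close> and \<open>y\<close>, there is a constant \<open>\<kappa> > 0\<close> with \<open>N (x @ y) \<ge> \<kappa> * N x * N y\<close> for every word \<open>x @ y\<close> of the
  language (\<open>almost_supermultiplicative\<close>). So \<open>ln N\<close> is additive up to a bounded error, and its growth rate
  is approximated within \<open>O(1 / k)\<close> by the orbit averages of \<open>ln N\<close> over words of length \<open>k\<close>, divided
  by \<open>k\<close> (\<open>convergent_almost_additive\<close>). These averages are finite combinations of
  word frequencies and converge.

  The convergence of frequencies is proved by compactness: a limit of frequencies of all words along
  a subsequence is a consistent shift-invariant system of weights, hence comes from an invariant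
  measure on \<open>Y\<close> (\<open>measure_with_cylinder_weights\<close>, \<open>invariant_probI\<close>), which can only be the given one.
\<close>

section \<open>Cylinders, open sets and Borel sets\<close>

lemma in_cylinder_iff: "x \<in> cylinder w \<longleftrightarrow> map x [0..<length w] = w"
proof -
  have "map x [0..<length w] = w \<longleftrightarrow> (\<forall>i<length w. map x [0..<length w] ! i = w ! i)"
    by (subst list_eq_iff_nth_eq) simp
  then show ?thesis by (simp add: cylinder_def)
qed

lemma cylinder_Nil [simp]: "cylinder [] = UNIV"
  by (simp add: cylinder_def)

lemma open_cylinder: "open (cylinder w)"
proof -
  have "cylinder w = (\<Inter>i<length w. (\<lambda>x. x i) -` {w ! i})"
    by (auto simp: cylinder_def)
  moreover have "open ((\<lambda>x::nat \<Rightarrow> nat. x i) -` {a})" for i a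
    by (rule open_vimage) (simp_all add: Topological_Spaces.open_discrete)
  ultimately show ?thesis
    by (simp add: open_INT)
qed

lemma open_contains_cylinder:
  fixes U :: "(nat \<Rightarrow> nat) set"
  assumes "open U" "x \<in> U"
  obtains n where "cylinder (map x [0..<n]) \<subseteq> U"
proof -
  have "openin (product_topology (\<lambda>i. euclidean) UNIV) U"
    using assms(1) by (simp add: euclidean_product_topology flip: open_openin)
  from product_topology_open_contains_basis[OF this assms(2)]
  obtain X where X: "x \<in> (\<Pi>\<^sub>E i\<in>UNIV. X i)" "finite {i. X i \<noteq> UNIV}" "(\<Pi>\<^sub>E i\<in>UNIV. X i) \<subseteq> U"
    by auto
  from X(2) obtain n where n: "\<And>i. X i \<noteq> UNIV \<Longrightarrow> i < n"
    by (auto simp: finite_nat_set_iff_bounded)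
  have "cylinder (map x [0..<n]) \<subseteq> (\<Pi>\<^sub>E i\<in>UNIV. X i)"
  proof
    fix y assume y: "y \<in> cylinder (map x [0..<n])"
    have "y i \<in> X i" for i
    proof (cases "i < n")
      case True
      then have "y i = x i" using y by (simp add: cylinder_def)
      then show ?thesis using X(1) by auto
    next
      case False
      then show ?thesis using n by blast
    qed
    then show "y \<in> (\<Pi>\<^sub>E i\<in>UNIV. X i)" by auto
  qed
  then have "cylinder (map x [0..<n]) \<subseteq> U" using X(3) by (rule order_trans)
  then show ?thesis by (rule that)
qed

lemma open_eq_Union_cylinders:
  fixes U :: "(nat \<Rightarrow> nat) set"
  assumes "open U"
  shows "U = (\<Union>w\<in>{w. cylinder w \<subseteq> U}. cylinder w)"
proof (intro equalityI subsetI)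
  fix x assume "x \<in> U"
  then obtain n where "cylinder (map x [0..<n]) \<subseteq> U"
    by (rule open_contains_cylinder[OF assms])
  moreover have "x \<in> cylinder (map x [0..<n])"
    by (simp add: in_cylinder_iff)
  ultimately show "x \<in> (\<Union>w\<in>{w. cylinder w \<subseteq> U}. cylinder w)"
    by (intro UN_I[of "map x [0..<n]"] CollectI)
next
  fix x assume "x \<in> (\<Union>w\<in>{w. cylinder w \<subseteq> U}. cylinder w)"
  then obtain w where "x \<in> cylinder w" "cylinder w \<subseteq> U" by blast
  then show "x \<in> U" by blast
qed

text \<open>
  There are only countably many words, so every open set is a countable union of cylinders. The
  empty set is added to make the generator stable under intersection.
\<close>

lemma sets_borel_eq_cylinders:
  "sets (borel :: (nat \<Rightarrow> nat) measure) = sigma_sets UNIV (insert {} (range cylinder))"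
proof -
  let ?C = "insert {} (range cylinder)"
  have "U \<in> sigma_sets UNIV ?C" if "open U" for U
  proof -
    have "(\<Union>w\<in>{w. cylinder w \<subseteq> U}. cylinder w) \<in> sigma_sets UNIV ?C"
      by (rule sigma_sets_UNION) (auto intro: countable_subset[OF subset_UNIV] sigma_sets.Basic)
    then show ?thesis
      by (rule back_subst[OF _ open_eq_Union_cylinders[OF that, symmetric],
            of "\<lambda>V. V \<in> sigma_sets UNIV ?C"])
  qed
  then have "sigma_sets UNIV {U. open U} \<subseteq> sigma_sets UNIV ?C"
    by (intro sigma_sets_mono) auto
  moreover have "sigma_sets UNIV ?C \<subseteq> sigma_sets UNIV {U. open U}"
    by (intro sigma_sets_mono') (auto intro: open_cylinder)
  moreover have "sets (borel :: (nat \<Rightarrow> nat) measure) = sigma_sets UNIV {U. open U}"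
    by (simp add: borel_def)
  ultimately show ?thesis
    by (metis subset_antisym)
qed

lemma cylinder_in_borel [measurable]: "cylinder w \<in> sets borel"
  by (rule borel_open, rule open_cylinder)

lemma cylinder_Int:
  "cylinder v \<inter> cylinder w \<in> insert {} (range cylinder)"
proof -
  have *: "cylinder v \<inter> cylinder w \<in> insert {} (range cylinder)"
    if "length v \<le> length w" for v w
  proof (cases "cylinder v \<inter> cylinder w = {}")
    case False
    then obtain z where z: "z \<in> cylinder v" "z \<in> cylinder w" by blast
    have eq: "v ! i = w ! i" if "i < length v" for i
    proof -
      have "z i = v ! i" using z(1) that unfolding cylinder_def by simp
      moreover have "z i = w ! i"
        using z(2) that \<open>length v \<le> length w\<close> unfolding cylinder_def by simp
      ultimately show ?thesis by simp
    qed
    have "cylinder w \<subseteq> cylinder v"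
    proof
      fix x assume "x \<in> cylinder w"
      then show "x \<in> cylinder v"
        using \<open>length v \<le> length w\<close> eq unfolding cylinder_def by (simp add: order_less_le_trans)
    qed
    then have "cylinder v \<inter> cylinder w = cylinder w" by (rule Int_absorb1)
    then show ?thesis by simp
  qed simp
  show ?thesis
    using *[of v w] *[of w v] linear[of "length v" "length w"] by (metis Int_commute)
qed

lemma measure_eqI_cylinders:
  assumes "sets M = sets borel" "sets N = sets borel" "emeasure M UNIV \<noteq> \<infinity>"
    and "\<And>w. emeasure M (cylinder w) = emeasure N (cylinder w)"
  shows "M = N"
proof (rule measure_eqI_generator_eq[where A = "\<lambda>_. UNIV"])
  show "Int_stable (insert {} (range cylinder))"
    using cylinder_Int by (intro Int_stableI) (elim insertE imageE, simp_all del: insert_iff add: insertI1)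
  show "range (\<lambda>_. UNIV) \<subseteq> insert {} (range cylinder)"
    by (auto intro: range_eqI[of _ _ "[]"])
  show "emeasure M X = emeasure N X" if "X \<in> insert {} (range cylinder)" for X
    using that assms(4) by auto
  show "sets M = sigma_sets UNIV (insert {} (range cylinder))"
    "sets N = sigma_sets UNIV (insert {} (range cylinder))"
    using assms(1,2) by (simp_all only: sets_borel_eq_cylinders)
qed (use assms(3) in simp_all)

section \<open>A measure with prescribed cylinder weights\<close>

text \<open>
  The construction cuts \<open>[0, 1)\<close> into consecutive intervals of lengths \<open>p [0]\<close>, \<open>p [1]\<close>, and so on,
  cuts each of these in the proportions \<open>p [i, 0]\<close>, \<open>p [i, 1]\<close>, and so on, and sends a point \<open>t\<close> to
  the sequence of indices of the intervals that contain it. A uniformly distributed \<open>t\<close> then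
  produces a sequence starting with \<open>w\<close> with probability \<open>p w\<close>, so that countable additivity comes
  for free from Lebesgue measure. The interval of the word \<open>w\<close> has left end \<open>left_end p w\<close>.
\<close>

definition left_end :: "(nat list \<Rightarrow> real) \<Rightarrow> nat list \<Rightarrow> real" where
  "left_end p w = (\<Sum>i<length w. \<Sum>k<w ! i. p (take i w @ [k]))"

text \<open>
  The right end of the interval of \<open>w @ [k]\<close> is the left end of that of \<open>w @ [Suc k]\<close>, and the letter
  after \<open>w\<close> is the first one whose interval has its right end beyond \<open>t\<close>.
\<close>

primrec expansion :: "(nat list \<Rightarrow> real) \<Rightarrow> real \<Rightarrow> nat \<Rightarrow> nat list" where
  "expansion p t 0 = []"
| "expansion p t (Suc n) =
     expansion p t n @ [LEAST k. t < left_end p (expansion p t n @ [Suc k])]"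

lemma left_end_snoc: "left_end p (w @ [k]) = left_end p w + (\<Sum>j<k. p (w @ [j]))"
  by (simp add: left_end_def nth_append)

lemma length_expansion [simp]: "length (expansion p t n) = n"
  by (induction n) auto

lemma map_expansion: "map (\<lambda>i. last (expansion p t (Suc i))) [0..<n] = expansion p t n"
  by (induction n) auto

context
  fixes m :: nat and p :: "nat list \<Rightarrow> real"
  assumes nonneg: "\<And>w. 0 \<le> p w"
    and total: "p [] = 1"
    and split: "\<And>w. p w = (\<Sum>k<m. p (w @ [k]))"
    and alphabet: "\<And>w k. k \<ge> m \<Longrightarrow> p (w @ [k]) = 0"
begin

lemma left_end_mono: "j \<le> k \<Longrightarrow> left_end p (w @ [j]) \<le> left_end p (w @ [k])"
  unfolding left_end_snoc using nonneg by (intro add_left_mono sum_mono2) auto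

lemma left_end_snoc_le: "left_end p (w @ [k]) \<le> left_end p w + p w"
proof -
  have "left_end p (w @ [k]) \<le> left_end p (w @ [max k m])"
    by (rule left_end_mono) simp
  also have "(\<Sum>j<max k m. p (w @ [j])) = (\<Sum>j<m. p (w @ [j]))"
    by (rule sum.mono_neutral_right) (auto intro: alphabet)
  then have "left_end p (w @ [max k m]) = left_end p w + p w"
    by (simp add: left_end_snoc flip: split)
  finally show ?thesis .
qed

lemma left_end_bounds: "0 \<le> left_end p w \<and> left_end p w + p w \<le> 1"
proof (induction w rule: rev_induct)
  case Nil
  then show ?case by (simp add: left_end_def total)
next
  case (snoc k w)
  have "left_end p (w @ [k]) + p (w @ [k]) = left_end p (w @ [Suc k])"
    by (simp add: left_end_snoc)
  with snoc left_end_snoc_le[of w "Suc k"] show ?case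
    using nonneg by (auto simp: left_end_snoc intro!: add_nonneg_nonneg sum_nonneg)
qed

lemma expansion_eq_iff:
  assumes "0 \<le> t" "t < 1"
  shows "expansion p t (length w) = w \<longleftrightarrow> left_end p w \<le> t \<and> t < left_end p w + p w"
proof (induction w rule: rev_induct)
  case Nil
  then show ?case using assms by (simp add: left_end_def total)
next
  case (snoc k w)
  define L where "L j = left_end p (w @ [j])" for j
  have L0: "L 0 = left_end p w" by (simp add: L_def left_end_snoc)
  have Lm: "L m = left_end p w + p w" by (simp add: L_def left_end_snoc flip: split)
  have Lk: "L (Suc k) = L k + p (w @ [k])" by (simp add: L_def left_end_snoc)
  have mono: "i \<le> j \<Longrightarrow> L i \<le> L j" for i j
    unfolding L_def by (rule left_end_mono)
  have le: "L j \<le> L m" for j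
    unfolding Lm unfolding L_def by (rule left_end_snoc_le)
  \<comment> \<open>The bound \<open>t < L m\<close> guarantees that the least index exists.\<close>
  have digit: "(LEAST j. t < L (Suc j)) = k \<longleftrightarrow> L k \<le> t \<and> t < L (Suc k)"
    if t: "L 0 \<le> t" "t < L m"
  proof
    assume k: "(LEAST j. t < L (Suc j)) = k"
    have "t < L (Suc m)" using t mono[of m "Suc m"] by simp
    then have "t < L (Suc k)" unfolding k[symmetric] by (rule LeastI)
    moreover have "L k \<le> t"
    proof (cases k)
      case (Suc i)
      then have "\<not> t < L (Suc i)" using k not_less_Least[of i "\<lambda>j. t < L (Suc j)"] by simp
      then show ?thesis using Suc by simp
    qed (use t in simp)
    ultimately show "L k \<le> t \<and> t < L (Suc k)" by simp
  next
    assume k: "L k \<le> t \<and> t < L (Suc k)"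
    show "(LEAST j. t < L (Suc j)) = k"
    proof (rule Least_equality)
      fix j assume "t < L (Suc j)"
      then have "L k < L (Suc j)" using k by simp
      then show "k \<le> j" using mono[of "Suc j" k] by (cases "Suc j \<le> k") auto
    qed (use k in simp)
  qed
  have "expansion p t (length (w @ [k])) = w @ [k] \<longleftrightarrow>
      expansion p t (length w) = w \<and> (LEAST j. t < L (Suc j)) = k"
    by (auto simp: L_def)
  also have "\<dots> \<longleftrightarrow> (L 0 \<le> t \<and> t < L m) \<and> (LEAST j. t < L (Suc j)) = k"
    by (simp add: snoc L0 Lm)
  also have "\<dots> \<longleftrightarrow> (L 0 \<le> t \<and> t < L m) \<and> L k \<le> t \<and> t < L (Suc k)"
    using digit by blast
  also have "\<dots> \<longleftrightarrow> L k \<le> t \<and> t < L (Suc k)"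
    using mono[of 0 k] le[of "Suc k"] by auto
  finally show ?case
    unfolding Lk by (simp add: L_def)
qed

text \<open>
  The conditions on \<open>p\<close> are exactly those that the weights \<open>w \<mapsto> M (cylinder w)\<close> of a probability
  measure \<open>M\<close> on sequences over \<open>{..<m}\<close> satisfy.
\<close>

lemma measure_with_cylinder_weights:
  "\<exists>M. prob_space M \<and> sets M = sets borel \<and> (\<forall>w. emeasure M (cylinder w) = ennreal (p w))"
proof -
  define X where "X t = (\<lambda>i. last (expansion p t (Suc i)))" for t
  define N where "N = restrict_space lborel {0..<1::real}"
  have N [simp]: "space N = {0..<1}" "sets N = sets (restrict_space borel {0..<1})"
    by (simp_all add: N_def space_restrict_space sets_restrict_space)
  have X: "X t \<in> cylinder w \<longleftrightarrow> expansion p t (length w) = w" for t w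
    unfolding in_cylinder_iff X_def map_expansion ..
  have pre: "X -` cylinder w \<inter> {0..<1} = {left_end p w ..< left_end p w + p w}" for w
    using expansion_eq_iff[of _ w] left_end_bounds[of w] by (auto simp: X)
  have "X -` cylinder w \<inter> space N \<in> sets N" for w
    using left_end_bounds[of w] by (auto simp: pre sets_restrict_space_iff)
  then have meas [measurable]: "X \<in> measurable N borel"
    by (intro measurable_sigma_sets[OF sets_borel_eq_cylinders]) auto
  define M where "M = distr N borel X"
  have weight: "emeasure M (cylinder w) = ennreal (p w)" for w
  proof -
    have "emeasure M (cylinder w) = emeasure N {left_end p w ..< left_end p w + p w}"
      by (simp add: M_def emeasure_distr pre)
    also have "\<dots> = ennreal (p w)"
      using left_end_bounds[of w] nonneg[of w]
      by (simp add: N_def emeasure_restrict_space)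
    finally show ?thesis .
  qed
  have "prob_space M"
    using weight[of "[]"] by (intro prob_spaceI) (simp add: M_def total)
  then show ?thesis using weight by (intro exI[of _ M]) (simp add: M_def)
qed

end

section \<open>Frequencies of words along orbits\<close>

definition language :: "(nat \<Rightarrow> nat) set \<Rightarrow> nat list set" where
  "language Y = {w. cylinder w \<inter> Y \<noteq> {}}"

definition freq :: "(nat \<Rightarrow> nat) \<Rightarrow> nat \<Rightarrow> nat list \<Rightarrow> real" where
  "freq x n w = (\<Sum>j<n. indicator (cylinder w) ((shift_map ^^ j) x)) / real n"

lemma funpow_shift_map: "(shift_map ^^ j) x = (\<lambda>i. x (j + i))"
  by (induction j) (auto simp: shift_map_def)

lemma subshift_funpow:
  assumes "subshift m Y" "x \<in> Y"
  shows "(shift_map ^^ j) x \<in> Y"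
  using assms by (induction j) (auto simp: subshift_def)

lemma language_letters:
  assumes "subshift m Y" "w \<in> language Y"
  shows "set w \<subseteq> {..<m}"
proof -
  obtain x where "x \<in> Y" and w: "map x [0..<length w] = w"
    using assms(2) by (auto simp: language_def in_cylinder_iff)
  then have "\<And>i. x i < m" using assms(1) by (simp add: subshift_def)
  then have "set (map x [0..<length w]) \<subseteq> {..<m}" by auto
  then show ?thesis unfolding w .
qed

lemma cylinder_snoc: "x \<in> cylinder (w @ [k]) \<longleftrightarrow> x \<in> cylinder w \<and> x (length w) = k"
  by (auto simp: in_cylinder_iff)

lemma cylinder_Cons: "x \<in> cylinder (k # w) \<longleftrightarrow> x 0 = k \<and> shift_map x \<in> cylinder w"
  by (auto simp: cylinder_def shift_map_def nth_Cons split: nat.splits)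

lemma indicator_cylinder_snoc:
  assumes "\<And>i. x i < m"
  shows "(\<Sum>k<m. indicator (cylinder (w @ [k])) x) = (indicator (cylinder w) x :: real)"
proof -
  have "(\<Sum>k<m. indicator (cylinder (w @ [k])) x) =
      (\<Sum>k<m. if k = x (length w) then indicator (cylinder w) x else (0::real))"
    by (intro sum.cong) (auto simp: cylinder_snoc indicator_def)
  then show ?thesis using assms by (simp add: sum.delta)
qed

lemma indicator_cylinder_Cons:
  assumes "\<And>i. x i < m"
  shows "(\<Sum>k<m. indicator (cylinder (k # w)) x) = (indicator (cylinder w) (shift_map x) :: real)"
proof -
  have "(\<Sum>k<m. indicator (cylinder (k # w)) x) =
      (\<Sum>k<m. if k = x 0 then indicator (cylinder w) (shift_map x) else (0::real))"
    by (intro sum.cong) (auto simp: cylinder_Cons indicator_def)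
  then show ?thesis using assms by (simp add: sum.delta)
qed

lemma freq_nonneg: "0 \<le> freq x n w"
  by (simp add: freq_def sum_nonneg)

lemma freq_le_1: "freq x n w \<le> 1"
proof -
  have "(\<Sum>j<n. indicator (cylinder w) ((shift_map ^^ j) x)) \<le> (\<Sum>j<n. 1::real)"
    by (intro sum_mono) (simp add: indicator_def)
  then show ?thesis by (simp add: freq_def divide_le_eq)
qed

lemma freq_Nil: "n > 0 \<Longrightarrow> freq x n [] = 1"
  by (simp add: freq_def)

lemma freq_eq_0:
  assumes "subshift m Y" "x \<in> Y" "w \<notin> language Y"
  shows "freq x n w = 0"
  using subshift_funpow[OF assms(1,2)] assms(3)
  by (auto simp: freq_def language_def indicator_def intro!: sum.neutral)

lemma freq_snoc:
  assumes "subshift m Y" "x \<in> Y"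
  shows "freq x n w = (\<Sum>k<m. freq x n (w @ [k]))"
proof -
  have "(\<Sum>k<m. freq x n (w @ [k])) =
      (\<Sum>j<n. \<Sum>k<m. indicator (cylinder (w @ [k])) ((shift_map ^^ j) x)) / real n"
    unfolding freq_def by (subst sum.swap) (simp add: sum_divide_distrib)
  also have "\<dots> = freq x n w"
    using subshift_funpow[OF assms] assms(1) unfolding freq_def subshift_def
    by (subst indicator_cylinder_snoc) auto
  finally show ?thesis by simp
qed

text \<open>
  Extending words to the left instead of to the right amounts to dropping the first point of the
  orbit segment and adding one at its end; this error of at most \<open>1 / n\<close> vanishes in the limit, which
  is why limits of frequencies are shift invariant.
\<close>

lemma freq_Cons:
  assumes "subshift m Y" "x \<in> Y"
  shows "\<bar>freq x n w - (\<Sum>k<m. freq x n (k # w))\<bar> \<le> 1 / real n"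
proof -
  define g where "g j = (indicator (cylinder w) ((shift_map ^^ j) x) :: real)" for j
  have g: "0 \<le> g j" "g j \<le> 1" for j by (auto simp: g_def indicator_def)
  have "(\<Sum>k<m. freq x n (k # w)) =
      (\<Sum>j<n. \<Sum>k<m. indicator (cylinder (k # w)) ((shift_map ^^ j) x)) / real n"
    unfolding freq_def by (subst sum.swap) (simp add: sum_divide_distrib)
  also have "\<dots> = (\<Sum>j<n. g (Suc j)) / real n"
    using subshift_funpow[OF assms] assms(1) unfolding g_def subshift_def
    by (subst indicator_cylinder_Cons) auto
  finally have "freq x n w - (\<Sum>k<m. freq x n (k # w)) = (\<Sum>j<n. g j - g (Suc j)) / real n"
    by (simp add: freq_def g_def sum_subtractf diff_divide_distrib)
  also have "\<dots> = (g 0 - g n) / real n"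
    by (simp add: sum_lessThan_telescope')
  finally show ?thesis
    using g[of 0] g[of n] by (simp add: abs_le_iff divide_right_mono)
qed

text \<open>
  By Tychonoff's theorem the functions with values in \<open>{a..b}\<close> form a compact space, which is
  metrisable because the index type is countable; so every subsequence has a further subsequence
  that converges in every coordinate simultaneously. It is the convergence of all coordinates
  that allows the hypothesis to relate the limits of different coordinates.
\<close>

lemma tendsto_unique_cluster:
  fixes f :: "nat \<Rightarrow> 'i::countable \<Rightarrow> real"
  assumes bounds: "\<And>n i. f n i \<in> {a..b}"
    and cluster: "\<And>r l. strict_mono r \<Longrightarrow> (\<And>i. (\<lambda>n. f (r n) i) \<longlonglongrightarrow> l i) \<Longrightarrow> l i0 = c"
  shows "(\<lambda>n. f n i0) \<longlonglongrightarrow> c"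
proof (rule ccontr)
  assume "\<not> (\<lambda>n. f n i0) \<longlonglongrightarrow> c"
  then obtain e where "e > 0" and e: "\<And>N. \<exists>n\<ge>N. \<not> \<bar>f n i0 - c\<bar> < e"
    unfolding LIMSEQ_iff by auto
  then have "infinite {n. e \<le> \<bar>f n i0 - c\<bar>}"
    unfolding infinite_nat_iff_unbounded_le by (auto simp: not_less)
  then obtain r0 :: "nat \<Rightarrow> nat" where r0: "strict_mono r0" "\<And>n. e \<le> \<bar>f (r0 n) i0 - c\<bar>"
    using infinite_enumerate by blast
  have "compactin (product_topology (\<lambda>i. euclidean) UNIV) (\<Pi>\<^sub>E i\<in>(UNIV::'i set). {a..b})"
    by (subst compactin_PiE) simp
  then have "compact (\<Pi>\<^sub>E i\<in>(UNIV::'i set). {a..b})"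
    by (simp add: euclidean_product_topology)
  then have "seq_compact (\<Pi>\<^sub>E i\<in>(UNIV::'i set). {a..b})"
    by (rule compact_imp_seq_compact)
  moreover have "\<forall>n. (f \<circ> r0) n \<in> (\<Pi>\<^sub>E i\<in>(UNIV::'i set). {a..b})"
    using bounds by (simp add: PiE_iff)
  ultimately obtain l r1 where r1: "strict_mono r1" "((f \<circ> r0) \<circ> r1) \<longlonglongrightarrow> l"
    by (rule seq_compactE)
  have lim: "(\<lambda>n. f (r0 (r1 n)) i) \<longlonglongrightarrow> l i" for i
    using continuous_on_tendsto_compose[OF continuous_on_product_coordinates[of i] r1(2)]
    by (simp only: comp_def UNIV_I eventually_True simp_thms)
  have "strict_mono (\<lambda>n. r0 (r1 n))"
    using strict_mono_o[OF r0(1) r1(1)] by (simp add: comp_def)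
  then have "l i0 = c" using cluster lim by blast
  then have "(\<lambda>n. f (r0 (r1 n)) i0) \<longlonglongrightarrow> c"
    using lim by metis
  then obtain n where "\<bar>f (r0 (r1 n)) i0 - c\<bar> < e"
    using \<open>e > 0\<close> unfolding LIMSEQ_iff real_norm_def by blast
  with r0(2)[of "r1 n"] show False by simp
qed

lemma borel_measurable_shift_map [measurable]: "shift_map \<in> measurable borel borel"
proof -
  have "continuous_on UNIV shift_map"
    unfolding shift_map_def
    by (intro continuous_on_coordinatewise_then_product continuous_on_product_coordinates)
  then show ?thesis by (rule borel_measurable_continuous_onI)
qed

text \<open>
  The complement of \<open>Y\<close> is open, hence a countable union of cylinders, and each of them belongs to a
  word outside the language. Invariance only has to be tested on cylinders; the preimage of
  \<open>cylinder w\<close> is the disjoint union of the cylinders of the words \<open>k # w\<close>.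
\<close>

lemma invariant_probI:
  fixes p :: "nat list \<Rightarrow> real"
  assumes Y: "subshift m Y"
    and M: "prob_space M" "sets M = sets borel" "\<And>w. emeasure M (cylinder w) = ennreal (p w)"
    and nonneg: "\<And>w. 0 \<le> p w"
    and outside: "\<And>w. w \<notin> language Y \<Longrightarrow> p w = 0"
    and shift: "\<And>w. p w = (\<Sum>k<m. p (k # w))"
  shows "invariant_prob Y M"
proof -
  interpret prob_space M by fact
  have space_M: "space M = UNIV"
    using M(2) sets_eq_imp_space_eq by force
  have [measurable]: "shift_map \<in> measurable M borel" "shift_map \<in> measurable M M"
    using borel_measurable_shift_map M(2) by (simp_all cong: measurable_cong_sets)
  have cyl: "cylinder w \<in> sets M" for w by (simp add: M(2) cylinder_in_borel)
  have closed: "closed Y" and letters: "\<And>x i. x \<in> Y \<Longrightarrow> x i < m"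
    using Y by (auto simp: subshift_def)
  have "open (- Y)" using closed by (simp add: open_Compl)
  have null: "(\<Union>w\<in>{w. cylinder w \<subseteq> - Y}. cylinder w) \<in> null_sets M"
  proof (rule null_sets_UN')
    fix w assume "w \<in> {w. cylinder w \<subseteq> - Y}"
    then have "w \<notin> language Y" by (auto simp: language_def)
    then show "cylinder w \<in> null_sets M"
      using outside M(3)[of w] cyl by (auto intro!: null_setsI)
  qed simp
  then have null: "- Y \<in> null_sets M"
    using open_eq_Union_cylinders[OF \<open>open (- Y)\<close>] by argo
  have Y_sets: "Y \<in> sets M" using closed M(2) by simp
  have "prob Y = 1"
    using null prob_compl[OF Y_sets] by (simp add: space_M Compl_eq_Diff_UNIV measure_def null_sets_def)
  then have mass: "emeasure M Y = 1"
    by (simp add: emeasure_eq_measure)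
  have AE_Y: "AE x in M. x \<in> Y"
    by (rule AE_I'[OF null]) auto
  have "distr M borel shift_map = M"
  proof (rule measure_eqI_cylinders)
    show "emeasure (distr M borel shift_map) UNIV \<noteq> \<infinity>"
      by (simp add: emeasure_distr)
    fix w
    have meas: "shift_map -` cylinder w \<inter> space M \<in> sets M"
      using measurable_sets[OF _ cylinder_in_borel] \<open>shift_map \<in> measurable M borel\<close> by blast
    have "emeasure (distr M borel shift_map) (cylinder w) =
        emeasure M (shift_map -` cylinder w \<inter> space M)"
      by (intro emeasure_distr) (simp_all add: cylinder_in_borel)
    also have "\<dots> = emeasure M (\<Union>k<m. cylinder (k # w))"
    proof (rule emeasure_eq_AE)
      show "AE x in M. x \<in> shift_map -` cylinder w \<inter> space M \<longleftrightarrow> x \<in> (\<Union>k<m. cylinder (k # w))"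
        using AE_Y by eventually_elim (auto simp: cylinder_Cons space_M letters)
    qed (use meas cyl in auto)
    also have "\<dots> = (\<Sum>k<m. emeasure M (cylinder (k # w)))"
      by (rule sum_emeasure[symmetric])
        (auto simp: cyl disjoint_family_on_def cylinder_Cons)
    also have "\<dots> = emeasure M (cylinder w)"
      using nonneg by (simp add: M(3) shift[of w] sum_ennreal)
    finally show "emeasure (distr M borel shift_map) (cylinder w) = emeasure M (cylinder w)" .
  qed (use M(2) in simp_all)
  with M(1,2) mass show ?thesis
    by (simp add: invariant_prob_def)
qed

text \<open>
  Oxtoby's theorem for cylinders. If the frequencies of all words converge along a subsequence, the
  limits are the cylinder weights of an invariant measure, and there is only one. The
  starting point may change with \<open>n\<close>, so this is convergence uniform over \<open>Y\<close>.
\<close>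

theorem freq_tendsto_measure:
  assumes Y: "subshift m Y" and ue: "uniquely_ergodic Y" and \<nu>: "invariant_prob Y \<nu>"
    and x: "\<And>n. x n \<in> Y"
  shows "(\<lambda>n. freq (x n) n w) \<longlonglongrightarrow> measure \<nu> (cylinder w)"
proof (rule tendsto_unique_cluster[where a = 0 and b = 1 and f = "\<lambda>n. freq (x n) n"])
  show "freq (x n) n w \<in> {0..1}" for n w
    by (simp add: freq_nonneg freq_le_1)
  fix r p
  assume r: "strict_mono r" and lim: "\<And>w. (\<lambda>n. freq (x (r n)) (r n) w) \<longlonglongrightarrow> p w"
  have r_inf: "filterlim r at_top sequentially"
    using r by (rule filterlim_subseq)
  have nonneg: "0 \<le> p w" for w
    by (rule LIMSEQ_le_const[OF lim]) (simp add: freq_nonneg)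
  have total: "p [] = 1"
  proof (rule LIMSEQ_unique[OF lim])
    have "\<forall>\<^sub>F n in sequentially. freq (x (r n)) (r n) [] = 1"
      using eventually_compose_filterlim[OF eventually_gt_at_top[of 0] r_inf]
      by eventually_elim (simp add: freq_Nil)
    then show "(\<lambda>n. freq (x (r n)) (r n) []) \<longlonglongrightarrow> 1"
      by (rule tendsto_eventually)
  qed
  have split: "p w = (\<Sum>k<m. p (w @ [k]))" for w
  proof (rule LIMSEQ_unique[OF lim])
    have "(\<lambda>n. \<Sum>k<m. freq (x (r n)) (r n) (w @ [k])) \<longlonglongrightarrow> (\<Sum>k<m. p (w @ [k]))"
      by (intro tendsto_sum lim)
    then show "(\<lambda>n. freq (x (r n)) (r n) w) \<longlonglongrightarrow> (\<Sum>k<m. p (w @ [k]))"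
      by (simp flip: freq_snoc[OF Y x])
  qed
  have shift: "p w = (\<Sum>k<m. p (k # w))" for w
  proof -
    have "(\<lambda>n. 1 / real n) \<longlonglongrightarrow> 0" by (rule lim_1_over_n)
    then have "(\<lambda>n. 1 / real (r n)) \<longlonglongrightarrow> 0"
      using r_inf by (rule filterlim_compose)
    then have "(\<lambda>n. freq (x (r n)) (r n) w - (\<Sum>k<m. freq (x (r n)) (r n) (k # w))) \<longlonglongrightarrow> 0"
      by (rule Lim_null_comparison[rotated]) (simp add: freq_Cons[OF Y x])
    moreover have "(\<lambda>n. freq (x (r n)) (r n) w - (\<Sum>k<m. freq (x (r n)) (r n) (k # w)))
        \<longlonglongrightarrow> p w - (\<Sum>k<m. p (k # w))"
      by (intro tendsto_diff tendsto_sum lim)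
    ultimately have "p w - (\<Sum>k<m. p (k # w)) = 0"
      by (rule LIMSEQ_unique[rotated])
    then show ?thesis by simp
  qed
  have outside: "p w = 0" if "w \<notin> language Y" for w
    using lim[of w] freq_eq_0[OF Y x that] by (simp add: LIMSEQ_const_iff)
  have alphabet: "p (w @ [k]) = 0" if "m \<le> k" for w k
    using that language_letters[OF Y, of "w @ [k]"] by (intro outside) auto
  have "\<exists>M. prob_space M \<and> sets M = sets borel \<and> (\<forall>w. emeasure M (cylinder w) = ennreal (p w))"
    using nonneg total split alphabet by (rule measure_with_cylinder_weights)
  then obtain M where M: "prob_space M" "sets M = sets borel"
      "\<And>w. emeasure M (cylinder w) = ennreal (p w)"
    by blast
  have "invariant_prob Y M"
    using Y M nonneg outside shift by (rule invariant_probI)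
  then have "M = \<nu>"
    using ue \<nu> unfolding uniquely_ergodic_def by blast
  then show "p w = measure \<nu> (cylinder w)"
    using M(3) nonneg by (metis enn2real_ennreal measure_def)
qed

lemma measure_cylinder_pos:
  assumes "invariant_prob Y \<nu>" "msupp \<nu> = Y" "w \<in> language Y"
  shows "0 < measure \<nu> (cylinder w)"
proof -
  interpret prob_space \<nu> using assms(1) by (simp add: invariant_prob_def)
  have "0 < emeasure \<nu> (cylinder w)"
    using assms(2,3) open_cylinder by (auto simp: msupp_def language_def)
  then show ?thesis by (simp add: emeasure_eq_measure)
qed

text \<open>
  Were there points avoiding \<open>w\<close> for longer and longer times, the frequency of \<open>w\<close> along their
  initial segments would be \<open>0\<close> and yet would converge to the positive measure of the cylinder.
  Since the frequencies converge for any choice of starting points, the bound \<open>R\<close> is uniform.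
\<close>

theorem bounded_gaps:
  assumes "subshift m Y" "uniquely_ergodic Y" "invariant_prob Y \<nu>" "msupp \<nu> = Y"
    and "w \<in> language Y"
  shows "\<exists>R. \<forall>x\<in>Y. \<exists>j<R. (shift_map ^^ j) x \<in> cylinder w"
proof (rule ccontr)
  assume "\<not> ?thesis"
  then have "\<exists>x\<in>Y. \<forall>j<R. (shift_map ^^ j) x \<notin> cylinder w" for R
    by blast
  then obtain x where x: "\<And>R. x R \<in> Y" "\<And>R j. j < R \<Longrightarrow> (shift_map ^^ j) (x R) \<notin> cylinder w"
    by metis
  then have "freq (x n) n w = 0" for n
    by (simp add: freq_def)
  with freq_tendsto_measure[OF assms(1-3), of x w] x(1) measure_cylinder_pos[OF assms(3-5)]
  show False by (simp add: LIMSEQ_const_iff)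
qed

section \<open>Words occurring in a subshift\<close>

lemma language_factor:
  assumes "subshift m Y" "x @ w @ y \<in> language Y"
  shows "w \<in> language Y"
proof -
  obtain z where z: "z \<in> Y" "z \<in> cylinder (x @ w @ y)"
    using assms(2) by (auto simp: language_def)
  have "(shift_map ^^ length x) z \<in> cylinder w"
    unfolding cylinder_def funpow_shift_map
  proof (intro CollectI allI impI)
    fix i assume "i < length w"
    then show "z (length x + i) = w ! i"
      using z(2) unfolding cylinder_def by (auto simp: nth_append dest: spec[of _ "length x + i"])
  qed
  with subshift_funpow[OF assms(1) z(1)] show ?thesis
    by (auto simp: language_def)
qed

lemma prefix_in_language: "x \<in> Y \<Longrightarrow> map x [0..<n] \<in> language Y"
  by (auto simp: language_def in_cylinder_iff)

lemma map_funpow_shift_map_add: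
  "map ((shift_map ^^ j) x) [0..<n + k] =
   map ((shift_map ^^ j) x) [0..<n] @ map ((shift_map ^^ (j + n)) x) [0..<k]"
  by (rule nth_equalityI) (auto simp: nth_append funpow_shift_map add.assoc)

lemma finite_language:
  assumes "subshift m Y"
  shows "finite {w \<in> language Y. length w \<le> n}"
  by (rule finite_subset[OF _ finite_lists_length_le[of "{..<m}" n]])
    (use language_letters[OF assms] in auto)

text \<open>
  A word of the language is the start of a point of \<open>Y\<close>, so it contains an occurrence of \<open>u\<close> that begins
  before position \<open>R\<close> as soon as it is long enough for that occurrence to end inside it.
\<close>

lemma language_split_at_word:
  assumes gaps: "\<And>x. x \<in> Y \<Longrightarrow> \<exists>j<R. (shift_map ^^ j) x \<in> cylinder u"
    and w: "w \<in> language Y" "R + length u \<le> length w"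
  obtains v v' where "w = v @ u @ v'" "length v < R"
proof -
  obtain x where "x \<in> Y" and x: "map x [0..<length w] = w"
    using w(1) by (auto simp: language_def in_cylinder_iff)
  then obtain j where j: "j < R" "(shift_map ^^ j) x \<in> cylinder u"
    using gaps by blast
  obtain r where r: "length w = j + (length u + r)"
    using j(1) w(2) le_iff_add[of "j + length u" "length w"] by auto
  have "[0..<length w] = [0..<j] @ [j..<j + length u] @ [j + length u..<length w]"
    unfolding r using upt_add_eq_append[of 0 j "length u + r"]
      upt_add_eq_append[of j "j + length u" r] by (simp add: add.assoc)
  then have "w = map x [0..<j] @ map x [j..<j + length u] @ map x [j + length u..<length w]"
    using x by (metis map_append)
  moreover have "map x [j..<j + length u] = u"
    using j(2) by (intro nth_equalityI) (auto simp: cylinder_def funpow_shift_map)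
  ultimately show ?thesis
    using that[of "map x [0..<j]" "map x [j + length u..<length w]"] j(1) by simp
qed

section \<open>Almost multiplicative weights on words\<close>

text \<open>
  The weight \<open>N w\<close> stands for the norm of the matrix product along \<open>w\<close>. Positivity of the product
  along \<open>u\<close> enters only through the hypothesis \<open>bridge\<close>: inserting \<open>u\<close> between two words reverses the
  submultiplicative inequality up to a constant.
\<close>

context
  fixes m :: nat and Y :: "(nat \<Rightarrow> nat) set" and u :: "nat list" and c :: real
    and R :: nat and N :: "nat list \<Rightarrow> real"
  assumes Y: "subshift m Y"
    and u: "u \<in> language Y"
    and gaps: "\<And>x. x \<in> Y \<Longrightarrow> \<exists>j<R. (shift_map ^^ j) x \<in> cylinder u"
    and submult: "\<And>x y. set (x @ y) \<subseteq> {..<m} \<Longrightarrow> N (x @ y) \<le> N x * N y"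
    and bridge: "\<And>x y. set (x @ y) \<subseteq> {..<m} \<Longrightarrow> c * N x * N y \<le> N (x @ u @ y)"
    and pos: "\<And>w. w \<in> language Y \<Longrightarrow> 0 < N w"
    and c_pos: "0 < c"
    and nonneg: "\<And>w. set w \<subseteq> {..<m} \<Longrightarrow> 0 \<le> N w"
begin

lemma weight_bounds:
  "\<exists>\<delta> K. 0 < \<delta> \<and> 0 < K \<and> (\<forall>w\<in>language Y. length w \<le> n \<longrightarrow> \<delta> \<le> N w \<and> N w \<le> K)"
proof -
  define W where "W = N ` {w \<in> language Y. length w \<le> n}"
  have "finite W" by (simp add: W_def finite_language[OF Y])
  have "[] \<in> language Y"
    using u language_factor[OF Y, of "[]" "[]" u] by simp
  then have "W \<noteq> {}" by (auto simp: W_def)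
  have "\<forall>a\<in>W. 0 < a" using pos by (auto simp: W_def)
  with \<open>finite W\<close> \<open>W \<noteq> {}\<close> have "0 < Min W" "0 < Max W"
    by (auto simp: Min_gr_iff Max_gr_iff)
  then show ?thesis
    using \<open>finite W\<close> by (intro exI[of _ "Min W"] exI[of _ "Max W"]) (auto simp: W_def)
qed

text \<open>
  In a long product \<open>x @ y\<close>, there are an occurrence of \<open>u\<close> in \<open>x\<close> and one in \<open>y\<close> within bounded distance
  of the junction. Cutting there with \<open>bridge\<close> splits off \<open>x\<close> and
  \<open>y\<close> up to words \<open>s\<close> and \<open>t\<close> of bounded length, and leaves the weight of \<open>s @ t\<close> in the middle. This
  word belongs to the language, so its weight is one of finitely many positive numbers. If \<open>x\<close> or \<open>y\<close> is itself
  short, then \<open>s = x\<close> or \<open>t = y\<close>, and the same inequalities hold since its weight is bounded.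
\<close>

lemma almost_supermultiplicative:
  obtains \<kappa> where "0 < \<kappa>" "\<And>x y. x @ y \<in> language Y \<Longrightarrow> \<kappa> * N x * N y \<le> N (x @ y)"
proof -
  define L where "L = R + length u"
  obtain \<delta> K where \<delta>: "0 < \<delta>" and K: "0 < K"
    and bounds: "\<And>w. w \<in> language Y \<Longrightarrow> length w \<le> 2 * L \<Longrightarrow> \<delta> \<le> N w \<and> N w \<le> K"
    using weight_bounds[of "2 * L"] by blast
  \<comment> \<open>Small enough for short words, where \<open>\<kappa> * K \<le> 1\<close> is needed, and for long ones, where
    \<open>\<kappa> * K \<le> c\<close> pays for the bridge and for the bounded word that is cut off.\<close>
  define \<kappa> where "\<kappa> = min 1 c / K"
  have \<kappa>: "0 < \<kappa>" using K c_pos by (simp add: \<kappa>_def)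
  have \<kappa>K: "\<kappa> * K \<le> 1" "\<kappa> * K \<le> c" using K by (auto simp: \<kappa>_def)
  note letters = language_letters[OF Y]
  have short: "\<kappa> * N w * a \<le> a" if "w \<in> language Y" "length w \<le> L" "0 \<le> a" for w a
  proof -
    have "\<kappa> * N w \<le> \<kappa> * K"
      using bounds[of w] that \<kappa> by (intro mult_left_mono) auto
    then show ?thesis
      using \<kappa>K(1) that(3) mult_right_mono[of "\<kappa> * N w" 1 a] by simp
  qed
  have left: "\<exists>x0 s. x = x0 @ s \<and> length s \<le> L \<and>
      (\<forall>z. set z \<subseteq> {..<m} \<longrightarrow> \<kappa> * N x * N (s @ z) \<le> N (x @ z))"
    if x: "x \<in> language Y" for x
  proof (cases "length x \<le> L")
    case True
    then have "\<forall>z. set z \<subseteq> {..<m} \<longrightarrow> \<kappa> * N x * N (x @ z) \<le> N (x @ z)"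
      using short[OF x] letters[OF x] nonneg by simp
    then show ?thesis using True by (intro exI[of _ "[]"] exI[of _ x]) simp
  next
    case False
    \<comment> \<open>Looking for \<open>u\<close> only in the last \<open>L\<close> letters of \<open>x\<close> keeps what follows it short.\<close>
    define w where "w = drop (length x - L) x"
    have w: "x = take (length x - L) x @ w @ []" by (simp add: w_def)
    have wl: "w \<in> language Y" by (rule language_factor[OF Y]) (rule back_subst[of "\<lambda>x. x \<in> language Y", OF x w])
    have "length w = L" using False by (simp add: w_def)
    then have "R + length u \<le> length w" by (simp add: L_def)
    with gaps wl obtain v s where vs: "w = v @ u @ s"
      by (rule language_split_at_word)
    define v' where "v' = take (length x - L) x @ v"
    have xeq: "x = v' @ u @ s" using w vs by (simp add: v'_def)
    have len: "length (u @ s) \<le> L" using vs \<open>length w = L\<close> by simp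
    have us: "u @ s \<in> language Y" using language_factor[OF Y, of v' "u @ s" "[]"] x xeq by simp
    have "N x \<le> N v' * N (u @ s)"
      using submult[of v' "u @ s"] letters[OF x] xeq by simp
    also have "\<dots> \<le> N v' * K"
      using bounds[OF us] len nonneg[of v'] letters[OF x] xeq by (intro mult_left_mono) auto
    finally have Nx: "N x \<le> N v' * K" .
    have "\<kappa> * N x * N (s @ z) \<le> N (x @ z)" if z: "set z \<subseteq> {..<m}" for z
    proof -
      have nn: "0 \<le> N (s @ z)" "0 \<le> N v'"
        using letters[OF x] z xeq by (auto intro!: nonneg)
      have "\<kappa> * N x \<le> \<kappa> * K * N v'"
        using mult_left_mono[OF Nx, of \<kappa>] \<kappa> by (simp add: ac_simps)
      also have "\<dots> \<le> c * N v'"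
        using \<kappa>K(2) nn(2) by (rule mult_right_mono)
      finally have "\<kappa> * N x * N (s @ z) \<le> c * N v' * N (s @ z)"
        using nn(1) by (rule mult_right_mono)
      also have "\<dots> \<le> N (v' @ u @ (s @ z))"
        using letters[OF x] z xeq by (intro bridge) auto
      finally show ?thesis by (simp add: xeq)
    qed
    then show ?thesis using xeq len by (intro exI[of _ "v' @ u"] exI[of _ s]) simp
  qed
  have right: "\<exists>t y0. y = t @ y0 \<and> length t \<le> L \<and>
      (\<forall>z. set z \<subseteq> {..<m} \<longrightarrow> \<kappa> * N y * N (z @ t) \<le> N (z @ y))"
    if y: "y \<in> language Y" for y
  proof (cases "length y \<le> L")
    case True
    then have "\<forall>z. set z \<subseteq> {..<m} \<longrightarrow> \<kappa> * N y * N (z @ y) \<le> N (z @ y)"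
      using short[OF y] letters[OF y] nonneg by simp
    then show ?thesis using True by (intro exI[of _ y] exI[of _ "[]"]) simp
  next
    case False
    then obtain t s where yeq: "y = t @ u @ s" and "length t < R"
      using language_split_at_word[OF gaps y] by (auto simp: L_def)
    have len: "length (t @ u) \<le> L" using \<open>length t < R\<close> by (simp add: L_def)
    have tu: "t @ u \<in> language Y" using language_factor[OF Y, of "[]" "t @ u" s] y yeq by simp
    have "N y \<le> N (t @ u) * N s"
      using submult[of "t @ u" s] letters[OF y] yeq by simp
    also have "\<dots> \<le> K * N s"
      using bounds[OF tu] len nonneg[of s] letters[OF y] yeq by (intro mult_right_mono) auto
    finally have Ny: "N y \<le> K * N s" .
    have "\<kappa> * N y * N (z @ t) \<le> N (z @ y)" if z: "set z \<subseteq> {..<m}" for z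
    proof -
      have nn: "0 \<le> N (z @ t)" "0 \<le> N s"
        using letters[OF y] z yeq by (auto intro!: nonneg)
      have "\<kappa> * N y \<le> \<kappa> * K * N s"
        using mult_left_mono[OF Ny, of \<kappa>] \<kappa> by (simp add: ac_simps)
      also have "\<dots> \<le> c * N s"
        using \<kappa>K(2) nn(2) by (rule mult_right_mono)
      finally have "\<kappa> * N y * N (z @ t) \<le> c * N s * N (z @ t)"
        using nn(1) by (rule mult_right_mono)
      also have "\<dots> = c * N (z @ t) * N s"
        by (simp add: ac_simps)
      also have "\<dots> \<le> N ((z @ t) @ u @ s)"
        using letters[OF y] z yeq by (intro bridge) auto
      finally show ?thesis by (simp add: yeq)
    qed
    then show ?thesis using yeq len by (intro exI[of _ t] exI[of _ "u @ s"]) simp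
  qed
  have "\<kappa> * \<kappa> * \<delta> * N x * N y \<le> N (x @ y)" if xy: "x @ y \<in> language Y" for x y
  proof -
    have x: "x \<in> language Y" and y: "y \<in> language Y"
      using language_factor[OF Y, of "[]" x y] language_factor[OF Y, of x y "[]"] xy by simp_all
    obtain x0 s where s: "x = x0 @ s" "length s \<le> L"
        "\<And>z. set z \<subseteq> {..<m} \<Longrightarrow> \<kappa> * N x * N (s @ z) \<le> N (x @ z)"
      using left[OF x] by blast
    obtain t y0 where t: "y = t @ y0" "length t \<le> L"
        "\<And>z. set z \<subseteq> {..<m} \<Longrightarrow> \<kappa> * N y * N (z @ t) \<le> N (z @ y)"
      using right[OF y] by blast
    have "s @ t \<in> language Y"
      using language_factor[OF Y, of x0 "s @ t" y0] xy s(1) t(1) by simp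
    then have "\<delta> \<le> N (s @ t)"
      using bounds[of "s @ t"] s(2) t(2) by simp
    then have "(\<kappa> * N x) * (\<kappa> * N y) * \<delta> \<le> (\<kappa> * N x) * (\<kappa> * N y) * N (s @ t)"
      using \<kappa> pos[OF x] pos[OF y] by (intro mult_left_mono) auto
    also have "\<dots> = (\<kappa> * N x) * (\<kappa> * N y * N (s @ t))"
      by (simp add: ac_simps)
    also have "\<dots> \<le> (\<kappa> * N x) * N (s @ y)"
      using \<kappa> pos[OF x] letters[OF x] s(1) by (intro mult_left_mono t(3)) auto
    also have "\<dots> \<le> N (x @ y)"
      using letters[OF y] by (rule s(3))
    finally show ?thesis by (simp add: ac_simps)
  qed
  then show ?thesis
    using \<kappa> \<delta> by (intro that[of "\<kappa> * \<kappa> * \<delta>"]) simp_all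
qed

end

section \<open>Growth rates of almost additive sequences\<close>

text \<open>
  A uniform limit, up to initial segments, of convergent sequences is Cauchy.
\<close>

lemma convergent_if_approximable:
  fixes g :: "nat \<Rightarrow> real"
  assumes "\<And>e. 0 < e \<Longrightarrow> \<exists>s. convergent s \<and> (\<forall>\<^sub>F n in sequentially. \<bar>g n - s n\<bar> \<le> e)"
  shows "convergent g"
proof -
  have "Cauchy g"
  proof (rule metric_CauchyI)
    fix e :: real assume "0 < e"
    then obtain s where "convergent s" and s: "\<forall>\<^sub>F n in sequentially. \<bar>g n - s n\<bar> \<le> e / 4"
      using assms[of "e / 4"] by auto
    then have "Cauchy s" by (simp add: Cauchy_convergent_iff)
    then obtain M1 where M1: "\<And>i j. M1 \<le> i \<Longrightarrow> M1 \<le> j \<Longrightarrow> dist (s i) (s j) < e / 4"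
      using metric_CauchyD[of s "e / 4"] \<open>0 < e\<close> by auto
    obtain M2 where M2: "\<And>n. M2 \<le> n \<Longrightarrow> \<bar>g n - s n\<bar> \<le> e / 4"
      using s by (auto simp: eventually_sequentially)
    have "dist (g i) (g j) < e" if "max M1 M2 \<le> i" "max M1 M2 \<le> j" for i j
    proof -
      have "\<bar>s i - s j\<bar> < e / 4" using M1[of i j] that by (simp add: dist_real_def)
      moreover have "\<bar>g i - s i\<bar> \<le> e / 4" "\<bar>g j - s j\<bar> \<le> e / 4"
        using M2[of i] M2[of j] that by simp_all
      ultimately show ?thesis
        using \<open>0 < e\<close> unfolding dist_real_def by linarith
    qed
    then show "\<exists>M. \<forall>i\<ge>M. \<forall>j\<ge>M. dist (g i) (g j) < e" by blast
  qed
  then show ?thesis by (simp add: Cauchy_convergent_iff)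
qed

lemma sum_shift_difference:
  fixes f :: "nat \<Rightarrow> real"
  shows "(\<Sum>j<n. f (j + k) - f j) = (\<Sum>i<k. f (n + i) - f i)"
proof (induction n)
  case (Suc n)
  have "f n + (\<Sum>i<k. f (Suc n + i)) = (\<Sum>i<Suc k. f (n + i))"
    by (subst sum.lessThan_Suc_shift) simp
  also have "\<dots> = (\<Sum>i<k. f (n + i)) + f (n + k)"
    by simp
  finally show ?case
    using Suc by (simp add: sum_subtractf)
qed simp

text \<open>
  For fixed \<open>k\<close>, the increments \<open>a 0 (j + k) - a 0 j\<close> are \<open>a j k\<close> up to \<open>C\<close>. Summed over \<open>j < n\<close> they
  telescope to \<open>k * a 0 n\<close> up to a constant that depends on \<open>k\<close>. Hence \<open>a 0 n / n\<close> is \<open>1 / k\<close> times the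
  average of \<open>a j k\<close> over \<open>j < n\<close>, up to \<open>C / k\<close> and a null sequence; the averages converge, and
  \<open>C / k\<close> is as small as desired.
\<close>

lemma convergent_almost_additive:
  fixes a :: "nat \<Rightarrow> nat \<Rightarrow> real"
  assumes additive: "\<And>j n k. \<bar>a j (n + k) - a j n - a (j + n) k\<bar> \<le> C"
    and bounded: "\<And>k. \<exists>D. \<forall>j. \<bar>a j k\<bar> \<le> D"
    and averages: "\<And>k. convergent (\<lambda>n. (\<Sum>j<n. a j k) / real n)"
  shows "convergent (\<lambda>n. a 0 n / real n)"
proof (rule convergent_if_approximable)
  fix e :: real assume "0 < e"
  obtain D where D: "\<And>j k. \<bar>a j k\<bar> \<le> D k"
    using bounded by metis
  have "0 \<le> C" using additive[of 0 0 0] by linarith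
  \<comment> \<open>\<open>C / k\<close> takes up half of the allowed error.\<close>
  obtain k :: nat where k: "2 * C / e < real k" using reals_Archimedean2 by blast
  moreover have "0 \<le> 2 * C / e" using \<open>0 \<le> C\<close> \<open>0 < e\<close> by simp
  ultimately have "0 < real k" by linarith
  define E where "E = (\<Sum>i<k. C + D i + \<bar>a 0 i\<bar>)"
  define S where "S n = (\<Sum>j<n. a j k)" for n
  have est: "\<bar>real k * a 0 n - S n\<bar> \<le> real n * C + E" for n
  proof -
    have "\<bar>(\<Sum>j<n. a 0 (j + k) - a 0 j) - S n\<bar> = \<bar>\<Sum>j<n. a 0 (j + k) - a 0 j - a j k\<bar>"
      by (simp add: S_def sum_subtractf)
    also have "\<dots> \<le> (\<Sum>j<n. C)"
      by (intro order_trans[OF sum_abs] sum_mono) (use additive[of 0 _ k] in simp)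
    finally have 1: "\<bar>(\<Sum>j<n. a 0 (j + k) - a 0 j) - S n\<bar> \<le> real n * C" by simp
    have "\<bar>real k * a 0 n - (\<Sum>i<k. a 0 (n + i) - a 0 i)\<bar> =
        \<bar>\<Sum>i<k. a 0 n - (a 0 (n + i) - a 0 i)\<bar>"
      by (simp add: sum_subtractf)
    also have "\<dots> \<le> E"
      unfolding E_def
    proof (intro order_trans[OF sum_abs] sum_mono)
      fix i
      show "\<bar>a 0 n - (a 0 (n + i) - a 0 i)\<bar> \<le> C + D i + \<bar>a 0 i\<bar>"
        using additive[of 0 n i] D[of n i] by simp
    qed
    finally show ?thesis
      using 1 unfolding sum_shift_difference by linarith
  qed
  have "(\<lambda>n. E / real n) \<longlonglongrightarrow> 0"
    by (rule lim_const_over_n)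
  then have "\<forall>\<^sub>F n in sequentially. E / real n < real k * e / 2"
    using \<open>0 < real k\<close> \<open>0 < e\<close> by (intro order_tendstoD(2)) auto
  then have "\<forall>\<^sub>F n in sequentially. \<bar>a 0 n / real n - S n / real n / real k\<bar> \<le> e"
    using eventually_gt_at_top[of 0]
  proof eventually_elim
    fix n :: nat assume n: "E / real n < real k * e / 2" "0 < n"
    have "\<bar>a 0 n / real n - S n / real n / real k\<bar> =
        \<bar>real k * a 0 n - S n\<bar> / (real n * real k)"
      using \<open>0 < real k\<close> n(2) by (simp add: field_simps flip: abs_divide[of _ "real n * real k", simplified])
    also have "\<dots> \<le> (real n * C + E) / (real n * real k)"
      using est by (intro divide_right_mono) auto
    also have "\<dots> = (C + E / real n) / real k"
      using n(2) by (simp add: field_simps)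
    also have "C \<le> real k * e / 2"
      using k \<open>0 < e\<close> by (simp add: field_simps)
    then have "(C + E / real n) / real k \<le> (real k * e / 2 + real k * e / 2) / real k"
      using n(1) by (intro divide_right_mono add_mono) auto
    also have "\<dots> = e" using \<open>0 < real k\<close> by simp
    finally show "\<bar>a 0 n / real n - S n / real n / real k\<bar> \<le> e" .
  qed
  moreover have "convergent (\<lambda>n. S n / real n / real k)"
  proof -
    obtain l where "(\<lambda>n. S n / real n) \<longlonglongrightarrow> l"
      using averages[of k] by (auto simp: S_def convergent_def)
    then have "(\<lambda>n. S n / real n / real k) \<longlonglongrightarrow> l / real k"
      using \<open>0 < real k\<close> by (intro tendsto_divide tendsto_const) simp_all
    then show ?thesis by (rule convergentI)
  qed
  ultimately show "\<exists>s. convergent s \<and> (\<forall>\<^sub>F n in sequentially. \<bar>a 0 n / real n - s n\<bar> \<le> e)"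
    by blast
qed

text \<open>
  A function of the first \<open>k\<close> letters is a finite linear combination of indicators of cylinders.
\<close>

lemma convergent_orbit_average:
  assumes Y: "subshift m Y" "uniquely_ergodic Y" "invariant_prob Y \<nu>" and x: "x \<in> Y"
  shows "convergent (\<lambda>n. (\<Sum>j<n. \<phi> (map ((shift_map ^^ j) x) [0..<k])) / real n)"
proof -
  define W where "W = {w \<in> language Y. length w = k}"
  have "finite W"
    by (rule finite_subset[OF _ finite_language[OF Y(1), of k]]) (auto simp: W_def)
  have "\<phi> (map ((shift_map ^^ j) x) [0..<k]) =
      (\<Sum>w\<in>W. indicator (cylinder w) ((shift_map ^^ j) x) * \<phi> w)" for j
  proof -
    let ?v = "map ((shift_map ^^ j) x) [0..<k]"
    have "?v \<in> W"
      using prefix_in_language[OF subshift_funpow[OF Y(1) x]] by (simp add: W_def)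
    have "(\<Sum>w\<in>W. indicator (cylinder w) ((shift_map ^^ j) x) * \<phi> w) =
        (\<Sum>w\<in>W. if w = ?v then \<phi> w else 0)"
      by (intro sum.cong refl) (auto simp: W_def in_cylinder_iff indicator_def)
    then show ?thesis using \<open>finite W\<close> \<open>?v \<in> W\<close> by simp
  qed
  then have "(\<Sum>j<n. \<phi> (map ((shift_map ^^ j) x) [0..<k])) =
      (\<Sum>w\<in>W. \<Sum>j<n. indicator (cylinder w) ((shift_map ^^ j) x) * \<phi> w)" for n
    by (subst sum.swap) (simp only:)
  then have "(\<Sum>j<n. \<phi> (map ((shift_map ^^ j) x) [0..<k])) / real n =
      (\<Sum>w\<in>W. freq x n w * \<phi> w)" for n
    by (simp only: freq_def sum_distrib_right sum_divide_distrib times_divide_eq_left)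
  moreover have "(\<lambda>n. \<Sum>w\<in>W. freq x n w * \<phi> w) \<longlonglongrightarrow> (\<Sum>w\<in>W. measure \<nu> (cylinder w) * \<phi> w)"
    using freq_tendsto_measure[OF Y, of "\<lambda>_. x"] x by (intro tendsto_intros) auto
  ultimately show ?thesis
    by (auto simp: convergent_def)
qed

section \<open>Products of non-negative matrices\<close>

lemma nonneg_mat_mult:
  fixes B C :: "real^'d^'d"
  shows "nonneg_mat B \<Longrightarrow> nonneg_mat C \<Longrightarrow> nonneg_mat (B ** C)"
  by (auto simp: nonneg_mat_def matrix_matrix_mult_def intro!: sum_nonneg)

lemma entry_norm_nonneg: "nonneg_mat B \<Longrightarrow> 0 \<le> entry_norm B"
  by (auto simp: nonneg_mat_def entry_norm_def intro!: sum_nonneg)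

lemma entry_norm_mult_le:
  fixes B C :: "real^'d^'d"
  assumes "nonneg_mat B" "nonneg_mat C"
  shows "entry_norm (B ** C) \<le> entry_norm B * entry_norm C"
proof -
  have B: "0 \<le> B $ i $ k" and C: "0 \<le> C $ i $ k" for i k
    using assms by (auto simp: nonneg_mat_def)
  have "entry_norm (B ** C) = (\<Sum>i\<in>UNIV. \<Sum>j\<in>UNIV. \<Sum>k\<in>UNIV. B $ i $ k * C $ k $ j)"
    by (simp add: entry_norm_def matrix_matrix_mult_def)
  also have "\<dots> = (\<Sum>i\<in>UNIV. \<Sum>k\<in>UNIV. B $ i $ k * (\<Sum>j\<in>UNIV. C $ k $ j))"
    by (subst sum.swap) (simp add: sum_distrib_left)
  also have "\<dots> \<le> (\<Sum>i\<in>UNIV. \<Sum>k\<in>UNIV. B $ i $ k * entry_norm C)"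
  proof (intro sum_mono mult_left_mono B)
    fix k :: 'd
    show "(\<Sum>j\<in>UNIV. C $ k $ j) \<le> entry_norm C"
      unfolding entry_norm_def
      by (rule member_le_sum[of k UNIV "\<lambda>k. \<Sum>j\<in>UNIV. C $ k $ j"]) (auto intro: sum_nonneg C)
  qed
  also have "\<dots> = entry_norm B * entry_norm C"
    by (simp add: entry_norm_def sum_distrib_right)
  finally show ?thesis .
qed

text \<open>
  In \<open>B ** C\<close> a large entry of \<open>B\<close> may meet only zeros of \<open>C\<close>. A positive matrix between them acts at
  least like \<open>c\<close> times the all-ones matrix \<open>J\<close>, and the norm of \<open>B ** J ** C\<close> is exactly the product of
  the norms of \<open>B\<close> and \<open>C\<close>.
\<close>

lemma entry_norm_sandwich_ge:
  fixes B C P :: "real^'d^'d"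
  assumes "nonneg_mat B" "nonneg_mat C" and P: "\<And>k l. c \<le> P $ k $ l"
  shows "c * entry_norm B * entry_norm C \<le> entry_norm (B ** P ** C)"
proof -
  have B: "0 \<le> B $ i $ k" and C: "0 \<le> C $ i $ k" for i k
    using assms by (auto simp: nonneg_mat_def)
  have "c * entry_norm B * entry_norm C =
      (\<Sum>i\<in>UNIV. \<Sum>k\<in>UNIV. \<Sum>l\<in>UNIV. \<Sum>j\<in>UNIV. B $ i $ k * c * C $ l $ j)"
    by (simp add: entry_norm_def sum_distrib_left sum_distrib_right ac_simps)
  also have "\<dots> \<le> (\<Sum>i\<in>UNIV. \<Sum>k\<in>UNIV. \<Sum>l\<in>UNIV. \<Sum>j\<in>UNIV. B $ i $ k * P $ k $ l * C $ l $ j)"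
    by (intro sum_mono mult_right_mono mult_left_mono B C P)
  also have "\<dots> = (\<Sum>i\<in>UNIV. \<Sum>l\<in>UNIV. \<Sum>k\<in>UNIV. \<Sum>j\<in>UNIV. B $ i $ k * P $ k $ l * C $ l $ j)"
    by (rule sum.cong[OF refl], rule sum.swap)
  also have "\<dots> = (\<Sum>i\<in>UNIV. \<Sum>l\<in>UNIV. \<Sum>j\<in>UNIV. \<Sum>k\<in>UNIV. B $ i $ k * P $ k $ l * C $ l $ j)"
    by (rule sum.cong[OF refl], rule sum.cong[OF refl], rule sum.swap)
  also have "\<dots> = (\<Sum>i\<in>UNIV. \<Sum>j\<in>UNIV. \<Sum>l\<in>UNIV. \<Sum>k\<in>UNIV. B $ i $ k * P $ k $ l * C $ l $ j)"
    by (rule sum.cong[OF refl], rule sum.swap)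
  also have "\<dots> = entry_norm (B ** P ** C)"
    by (simp add: entry_norm_def matrix_matrix_mult_def sum_distrib_right)
  finally show ?thesis .
qed

lemma word_prod_append: "word_prod A (x @ y) = word_prod A x ** word_prod A y"
  by (induction x) (simp_all add: word_prod_def matrix_mul_assoc)

lemma nonneg_word_prod:
  assumes "\<And>i. i < m \<Longrightarrow> nonneg_mat (A i)"
  shows "set w \<subseteq> {..<m} \<Longrightarrow> nonneg_mat (word_prod A w)"
proof (induction w)
  case Nil
  then show ?case by (simp add: word_prod_def nonneg_mat_def mat_def)
next
  case (Cons i w)
  then show ?case using assms nonneg_mat_mult[of "A i" "word_prod A w"]
    by (simp add: word_prod_def)
qed

lemma pos_mat_lower_bound:
  fixes P :: "real^'d^'d"
  assumes "pos_mat P"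
  obtains c where "0 < c" "\<And>k l. c \<le> P $ k $ l"
proof -
  define V where "V = range (\<lambda>(k, l). P $ k $ l)"
  have "0 < Min V"
    using assms by (auto simp: V_def pos_mat_def Min_gr_iff)
  moreover have "Min V \<le> P $ k $ l" for k l
    unfolding V_def by (intro Min_le) (auto intro: range_eqI[of _ _ "(k, l)"])
  ultimately show ?thesis by (rule that)
qed

section \<open>Existence of the Lyapunov exponent\<close>

theorem corollary1p4:
  fixes m :: nat
    and Y :: "(nat \<Rightarrow> nat) set"
    and \<nu> :: "(nat \<Rightarrow> nat) measure"
    and A :: "nat \<Rightarrow> real^'d^'d"
    and u :: "nat list"
  assumes "m \<ge> 2"
    and "subshift m Y"
    and "uniquely_ergodic Y"
    and "invariant_prob Y \<nu>"
    and "msupp \<nu> = Y"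
    and "\<And>i. i < m \<Longrightarrow> nonneg_mat (A i)"
    and "u \<noteq> []" and "set u \<subseteq> {..<m}"
    and "cylinder u \<inter> msupp \<nu> \<noteq> {}"
    and "pos_mat (word_prod A u)"
  shows "\<forall>\<omega>\<in>Y. \<exists>L::ereal. L < \<infinity> \<and>
           (\<lambda>n. ereal (1 / real n) * ext_log (entry_norm (word_prod A (map \<omega> [0..<n]))))
             \<longlonglongrightarrow> L"
proof
  note Y = assms(2) and ergodic = assms(2-4) and recurrence = bounded_gaps[OF assms(2-5)]
  define N where "N w = entry_norm (word_prod A w)" for w
  have nn_mat: "nonneg_mat (word_prod A w)" if "set w \<subseteq> {..<m}" for w
    using nonneg_word_prod[of m A, OF assms(6) that] .
  have nonneg: "0 \<le> N w" if "set w \<subseteq> {..<m}" for w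
    unfolding N_def using nn_mat[OF that] by (rule entry_norm_nonneg)
  have submult: "N (x @ y) \<le> N x * N y" if "set (x @ y) \<subseteq> {..<m}" for x y
    unfolding N_def word_prod_append using that by (intro entry_norm_mult_le nn_mat) auto
  have u: "u \<in> language Y" using assms(5,9) by (simp add: language_def)
  obtain c where c: "0 < c" "\<And>k l. c \<le> word_prod A u $ k $ l"
    using pos_mat_lower_bound[OF assms(10)] by blast
  have bridge: "c * N x * N y \<le> N (x @ u @ y)" if "set (x @ y) \<subseteq> {..<m}" for x y
  proof -
    have "word_prod A (x @ u @ y) = word_prod A x ** word_prod A u ** word_prod A y"
      by (simp add: word_prod_append matrix_mul_assoc)
    then show ?thesis
      unfolding N_def using that c(2) by (simp add: entry_norm_sandwich_ge nn_mat)
  qed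
  fix \<omega> assume \<omega>: "\<omega> \<in> Y"
  define a where "a n = ereal (1 / real n) * ext_log (N (map \<omega> [0..<n]))" for n
  have "\<exists>L<\<infinity>. a \<longlonglongrightarrow> L"
  proof (cases "\<exists>w\<in>language Y. N w = 0")
    \<comment> \<open>The word \<open>w\<close> occurs in \<open>\<omega>\<close>, and all products beyond its first occurrence vanish.\<close>
    case True
    then obtain w where w: "w \<in> language Y" "N w = 0" by blast
    obtain j where j: "(shift_map ^^ j) \<omega> \<in> cylinder w"
      using recurrence[OF w(1)] \<omega> by blast
    have zero: "N (map \<omega> [0..<n]) = 0" if n: "j + length w \<le> n" for n
    proof -
      obtain r where r: "n = j + (length w + r)" using n le_iff_add by (metis add.assoc)
      have word: "map \<omega> [0..<n] = map \<omega> [0..<j] @ w @ map ((shift_map ^^ (j + length w)) \<omega>) [0..<r]"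
        using map_funpow_shift_map_add[of 0 \<omega> j "length w + r"]
          map_funpow_shift_map_add[of j \<omega> "length w" r] j
        by (simp add: r in_cylinder_iff)
      define x y where "x = map \<omega> [0..<j]" and "y = map ((shift_map ^^ (j + length w)) \<omega>) [0..<r]"
      have letters: "set (x @ w @ y) \<subseteq> {..<m}"
        using language_letters[OF Y prefix_in_language[OF \<omega>, of n]] word by (simp add: x_def y_def)
      have "N (x @ w @ y) \<le> N x * (N w * N y)"
        using submult[of x "w @ y"] submult[of w y] nonneg[of x] letters
        by (auto intro: order_trans[OF _ mult_left_mono])
      then show ?thesis
        using nonneg[OF letters] w(2) word by (simp add: x_def y_def)
    qed
    have "\<forall>\<^sub>F n in sequentially. a n = - \<infinity>"
      using eventually_ge_at_top[of "j + length w + 1"]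
      by eventually_elim (simp add: a_def ext_log_def zero)
    then have "a \<longlonglongrightarrow> - \<infinity>" by (rule tendsto_eventually)
    then show ?thesis by (intro exI[of _ "- \<infinity>"]) simp
  next
    case False
    have pos: "0 < N w" if "w \<in> language Y" for w
      using nonneg[OF language_letters[OF Y that]] False that by force
    obtain R where gaps: "\<And>x. x \<in> Y \<Longrightarrow> \<exists>j<R. (shift_map ^^ j) x \<in> cylinder u"
      using recurrence[OF u] by blast
    obtain \<kappa> where \<kappa>: "0 < \<kappa>" "\<And>x y. x @ y \<in> language Y \<Longrightarrow> \<kappa> * N x * N y \<le> N (x @ y)"
      using almost_supermultiplicative[OF Y u gaps submult bridge pos c(1) nonneg] by blast
    define v where "v j n = map ((shift_map ^^ j) \<omega>) [0..<n]" for j n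
    have v: "v j n \<in> language Y" for j n
      unfolding v_def by (intro prefix_in_language subshift_funpow[OF Y \<omega>])
    have v_add: "v j (n + k) = v j n @ v (j + n) k" for j n k
      unfolding v_def by (rule map_funpow_shift_map_add)
    have "convergent (\<lambda>n. ln (N (v 0 n)) / real n)"
    proof (rule convergent_almost_additive[where C = "\<bar>ln \<kappa>\<bar>"])
      fix j n k
      have p: "0 < N (v j n)" "0 < N (v (j + n) k)" "0 < N (v j (n + k))"
        using pos v by simp_all
      have "ln (N (v j (n + k))) \<le> ln (N (v j n) * N (v (j + n) k))"
        using submult[of "v j n" "v (j + n) k"] language_letters[OF Y v, of j "n + k"] p
        by (simp add: v_add)
      moreover have "ln (\<kappa> * N (v j n) * N (v (j + n) k)) \<le> ln (N (v j (n + k)))"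
        using \<kappa>(2)[of "v j n" "v (j + n) k"] v[of j "n + k"] p \<kappa>(1)
        by (simp add: v_add)
      ultimately show "\<bar>ln (N (v j (n + k))) - ln (N (v j n)) - ln (N (v (j + n) k))\<bar> \<le> \<bar>ln \<kappa>\<bar>"
        using p \<kappa>(1) by (simp add: ln_mult)
    next
      fix k
      have "finite ((\<lambda>w. \<bar>ln (N w)\<bar>) ` {w \<in> language Y. length w \<le> k})"
        by (intro finite_imageI finite_language[OF Y])
      then have "\<bar>ln (N (v j k))\<bar> \<le> Max ((\<lambda>w. \<bar>ln (N w)\<bar>) ` {w \<in> language Y. length w \<le> k})" for j
        using v[of j k] by (intro Max_ge imageI) (auto simp: v_def)
      then show "\<exists>D. \<forall>j. \<bar>ln (N (v j k))\<bar> \<le> D" by blast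
      show "convergent (\<lambda>n. (\<Sum>j<n. ln (N (v j k))) / real n)"
        unfolding v_def by (rule convergent_orbit_average[OF ergodic \<omega>])
    qed
    then obtain l where "(\<lambda>n. ln (N (v 0 n)) / real n) \<longlonglongrightarrow> l"
      by (auto simp: convergent_def)
    then have "(\<lambda>n. ereal (ln (N (v 0 n)) / real n)) \<longlonglongrightarrow> ereal l"
      by (rule tendsto_ereal)
    moreover have "a = (\<lambda>n. ereal (ln (N (v 0 n)) / real n))"
    proof
      fix n
      show "a n = ereal (ln (N (v 0 n)) / real n)"
        using pos[OF v, of 0 n] by (simp add: a_def ext_log_def v_def)
    qed
    ultimately show ?thesis by (intro exI[of _ "ereal l"]) simp
  qed
  then show "\<exists>L::ereal. L < \<infinity> \<and>
      (\<lambda>n. ereal (1 / real n) * ext_log (entry_norm (word_prod A (map \<omega> [0..<n])))) \<longlonglongrightarrow> L"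
    by (simp add: a_def[abs_def] N_def)
qed

end
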